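(* Suppose $N_A=1$ (SIMOME scenario) and let $\mathcal{P}_T>0$. Let $c_{x|u}$ be a fixed precoder distribution (a conditional distribution of $x\in\mathbb{C}$ given $u$), and let $p_{(u,x)}=p_u c_{x|u}$ and $q_{(u,x)}=q_u c_{x|u}$ be two input distributions sharing this precoder and such that $\mathbb{E}[|x|^2]=\mathcal{P}_T$ under each of them. Then exactly one of the following two statements holds: (i) For all channel statistics $p_{\mathbf{h}}$ and $p_{\mathbf{g}}$, $$\mathrm{ESR}(p_{(u,x)},p_{\mathbf{h}},p_{\mathbf{g}})=\mathrm{ESR}(q_{(u,x)},p_{\mathbf{h}},p_{\mathbf{g}}).$$ (ii) There exist channel statistics $p_{\mathbf{h}}$ and $p_{\mathbf{g}}$ such that $$\mathrm{ESR}(p_{(u,x)},p_{\mathbf{h}},p_{\mathbf{g}})<\mathrm{ESR}(q_{(u,x)},p_{\mathbf{h}},p_{\mathbf{g}}).$$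
   Context: Channel model (SIMOME: single transmit antenna). Let $N_B,N_E\ge1$ be integers. A message $u$, a random variable in an arbitrary set $\mathcal{U}$, is encoded into a complex random variable $x\in\mathbb{C}$; the joint law of $(u,x)$ is the input distribution. The legitimate receiver observes $\mathbf{y}=\mathbf{h}x+\mathbf{w}_B\in\mathbb{C}^{N_B}$ and the eavesdropper observes $\mathbf{z}=\mathbf{g}x+\mathbf{w}_E\in\mathbb{C}^{N_E}$, where $\mathbf{h}\in\mathbb{C}^{N_B}$ and $\mathbf{g}\in\mathbb{C}^{N_E}$ are random vectors with distributions $p_{\mathbf{h}}$ and $p_{\mathbf{g}}$ (the channel statistics), independent of $(u,x)$, and $\mathbf{w}_B,\mathbf{w}_E$ are circularly symmetric complex Gaussian noise vectors with identity covariance, independent of each other and of everything else. For an input distribution $d_{(u,x)}$, the ergodic secrecy rate is $\mathrm{ESR}(d_{(u,x)},p_{\mathbf{h}},p_{\mathbf{g}})=\mathbb{E}_{\mathbf{h},\mathbf{g}}[I(u;\mathbf{y})-I(u;\mathbf{z})]$ when $(u,x)\sim d_{(u,x)}$, where $I(u;\mathbf{y})$ and $I(u;\mathbf{z})$ are the Shannon mutual informations (in bits) for the instantaneous channel states, i.e. $I(u;\mathbf{y}\mid\mathbf{h}=\mathbf{h}_0)$ evaluated at $\mathbf{h}_0=\mathbf{h}$ and $I(u;\mathbf{z}\mid\mathbf{g}=\mathbf{g}_0)$ evaluated at $\mathbf{g}_0=\mathbf{g}$. *)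

theory Defs
  imports "HOL-Probability.Probability"
begin

text \<open>
  Laws are measures: an element of \<^term>\<open>space (prob_algebra S)\<close> is a probability measure on the
  measurable space \<^term>\<open>S\<close>, and a conditional distribution (precoder) is a Markov kernel
  \<^term>\<open>c \<in> measurable U (prob_algebra borel)\<close>.  The message alphabet \<^term>\<open>U\<close> is an arbitrary
  measurable space; \<open>complex ^ 'n\<close> is the space of complex vectors with \<^term>\<open>CARD('n)\<close> entries.
\<close>

definition input_dist ::
  "'u measure \<Rightarrow> 'u measure \<Rightarrow> ('u \<Rightarrow> complex measure) \<Rightarrow> ('u \<times> complex) measure" where
  "input_dist U p c = p \<bind> (\<lambda>u. c u \<bind> (\<lambda>x. return (U \<Otimes>\<^sub>M borel) (u, x)))"

lemma input_dist_in_prob_algebra: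
  assumes [measurable]: "c \<in> measurable U (prob_algebra borel)"
    and p: "p \<in> space (prob_algebra U)"
  shows "input_dist U p c \<in> space (prob_algebra (U \<Otimes>\<^sub>M borel))"
proof -
  have "(\<lambda>u. c u \<bind> (\<lambda>x. return (U \<Otimes>\<^sub>M borel) (u, x)))
      \<in> measurable U (prob_algebra (U \<Otimes>\<^sub>M borel))"
    by measurable
  with p have "(\<lambda>_. input_dist U p c) \<in> measurable (count_space (UNIV :: unit set))
      (prob_algebra (U \<Otimes>\<^sub>M borel))"
    unfolding input_dist_def by (intro measurable_bind_prob_space[where N = U]) auto
  from measurable_space[OF this, of "()"] show ?thesis
    by simp
qed

text \<open>
  The circularly symmetric complex Gaussian law with mean zero and identity covariance: real and
  imaginary parts of all entries are independent with variance one half.  Here \<^term>\<open>lborel\<close>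
  is Lebesgue measure on the underlying real space of dimension twice \<^term>\<open>CARD('n)\<close>.
\<close>

definition complex_gaussian :: "(complex ^ 'n) measure" where
  "complex_gaussian = density lborel (\<lambda>w. ennreal (exp (- (norm w)\<^sup>2) / pi ^ CARD('n)))"

lemma prob_space_complex_gaussian: "prob_space (complex_gaussian :: (complex ^ 'n) measure)"
proof
  let ?f = "\<lambda>x. normal_density 0 (sqrt (1/2)) x"
  have f: "?f x = exp (- x\<^sup>2) / sqrt pi" for x
    by (simp add: normal_density_def)
  have one: "(\<integral>\<^sup>+x. ennreal (?f x) \<partial>lborel) = 1"
    by (subst nn_integral_eq_integral) (auto intro: integrable_normal_density integral_normal_density)
  have dens: "exp (- (norm w)\<^sup>2) / pi ^ CARD('n) = (\<Prod>b\<in>Basis. ?f (w \<bullet> b))"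
    for w :: "complex ^ 'n"
  proof -
    have "(\<Prod>b\<in>(Basis :: (complex ^ 'n) set). ?f (w \<bullet> b))
        = exp (\<Sum>b\<in>Basis. - (w \<bullet> b)\<^sup>2) / sqrt pi ^ DIM(complex ^ 'n)"
      by (simp only: f prod_dividef prod_constant exp_sum[OF finite_Basis])
    also have "(\<Sum>b\<in>Basis. - (w \<bullet> b)\<^sup>2) = - (norm w)\<^sup>2"
      unfolding sum_negf power2_norm_eq_inner euclidean_inner[of w w] by (simp add: power2_eq_square)
    also have "sqrt pi ^ DIM(complex ^ 'n) = pi ^ CARD('n)"
      by (simp add: power_mult mult.commute[of _ 2])
    finally show ?thesis ..
  qed
  have "emeasure (complex_gaussian :: (complex ^ 'n) measure) (space complex_gaussian)
      = (\<integral>\<^sup>+w. (\<Prod>b\<in>Basis. ennreal (?f (w \<bullet> b))) \<partial>(lborel :: (complex ^ 'n) measure))"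
    unfolding complex_gaussian_def
    by (subst emeasure_density) (auto simp: dens prod_ennreal normal_density_nonneg)
  also have "\<dots> = 1"
    by (subst nn_integral_lborel_prod) (auto simp: one)
  finally show "emeasure (complex_gaussian :: (complex ^ 'n) measure) (space complex_gaussian) = 1" .
qed

text \<open>
  The mutual information, in bits, between the message and the output \<open>h x + w\<close> of the channel with
  fixed gain vector \<^term>\<open>h\<close>, for \<open>(u, x)\<close> with law \<^term>\<open>d\<close> independent of the noise \<open>w\<close>.
  The library's real-valued mutual information carries no junk here: the output has a positive
  density given the message, and the value is finite when \<open>x\<close> has finite second moment.
\<close>

definition channel_mi ::
  "'u measure \<Rightarrow> ('u \<times> complex) measure \<Rightarrow> (complex ^ 'n) \<Rightarrow> real" where
  "channel_mi U d h = prob_space.mutual_information (d \<Otimes>\<^sub>M complex_gaussian) 2 U borel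
     (\<lambda>((u, x), w). u) (\<lambda>((u, x), w). x *s h + w)"

text \<open>
  The expectation with values in the extended reals, defined unless the positive and the
  negative part both have infinite expectation.
\<close>

definition has_ext_expectation :: "'a measure \<Rightarrow> ('a \<Rightarrow> real) \<Rightarrow> bool" where
  "has_ext_expectation M f \<longleftrightarrow> f \<in> borel_measurable M \<and>
     ((\<integral>\<^sup>+x. ennreal (f x) \<partial>M) \<noteq> \<infinity> \<or> (\<integral>\<^sup>+x. ennreal (- f x) \<partial>M) \<noteq> \<infinity>)"

definition ext_expectation :: "'a measure \<Rightarrow> ('a \<Rightarrow> real) \<Rightarrow> ereal" where
  "ext_expectation M f =
     enn2ereal (\<integral>\<^sup>+x. ennreal (f x) \<partial>M) - enn2ereal (\<integral>\<^sup>+x. ennreal (- f x) \<partial>M)"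

definition secrecy_rate ::
  "'u measure \<Rightarrow> ('u \<times> complex) measure \<Rightarrow> (complex ^ 'b) \<times> (complex ^ 'e) \<Rightarrow> real" where
  "secrecy_rate U d = (\<lambda>(h, g). channel_mi U d h - channel_mi U d g)"

text \<open>
  The joint law of the two gain vectors is taken to be the product of the channel statistics.  The
  choice is immaterial: the secrecy rate is a difference of a function of \<open>h\<close> and a function of
  \<open>g\<close>, both nonnegative, so as soon as its expectation exists under the product law, every other
  joint law with the same marginals gives the same value.
\<close>

definition ESR_defined ::
  "'u measure \<Rightarrow> ('u \<times> complex) measure \<Rightarrow> (complex ^ 'b) measure \<Rightarrow> (complex ^ 'e) measure \<Rightarrow> bool"
  where "ESR_defined U d ph pg \<longleftrightarrow> has_ext_expectation (ph \<Otimes>\<^sub>M pg) (secrecy_rate U d)"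

definition ESR ::
  "'u measure \<Rightarrow> ('u \<times> complex) measure \<Rightarrow> (complex ^ 'b) measure \<Rightarrow> (complex ^ 'e) measure \<Rightarrow> ereal"
  where "ESR U d ph pg = ext_expectation (ph \<Otimes>\<^sub>M pg) (secrecy_rate U d)"

end

theory Submission
  imports Defs
begin

text \<open>
  Relative to the law \<open>p\<^sub>u \<otimes> \<gamma>\<close>, with \<open>\<gamma>\<close> the noise law, the pair of message and output has a
  density at \<open>(u, y)\<close> that depends on \<open>y\<close> only through the matched filter output \<open>h\<^sup>* y\<close>, and on \<open>h\<close>
  otherwise only through its norm.  Under \<open>\<gamma>\<close> the matched filter output is a circularly symmetric
  Gaussian of variance \<open>\<parallel>h\<parallel>\<^sup>2\<close>.  So the mutual information is a function of \<open>\<parallel>h\<parallel>\<close> alone, whatever the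
  number of receive antennas.  If the two ergodic rates differ for some channel statistics, then the
  two instantaneous secrecy rates differ at some \<open>(h, g)\<close>.  Exchanging the norms of \<open>h\<close> and \<open>g\<close>
  negates both secrecy rates, so one of the two deterministic channels has the required sign.
\<close>

section \<open>Rotation invariance of the planar Gaussian law\<close>

text \<open>Substitution in one variable and Fubini suffice. If \<open>c \<noteq> 0\<close>, first
  \<open>c * x - s * y\<close> becomes the new \<open>x\<close> at fixed \<open>y\<close>, then
  \<open>(s * x + y) / c\<close> becomes the new \<open>y\<close> at fixed \<open>x\<close>; the two
  scaling factors are inverse to each other. If \<open>c = 0\<close>, the map swaps the coordinates
  up to signs.\<close>

lemma nn_integral_lborel_rotate:
  fixes F :: "real \<Rightarrow> real \<Rightarrow> ennreal"
  assumes [measurable]: "case_prod F \<in> borel_measurable (borel \<Otimes>\<^sub>M borel)"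
    and cs: "c\<^sup>2 + s\<^sup>2 = 1"
  shows "(\<integral>\<^sup>+x. \<integral>\<^sup>+y. F (c * x - s * y) (s * x + c * y) \<partial>lborel \<partial>lborel)
    = (\<integral>\<^sup>+x. \<integral>\<^sup>+y. F x y \<partial>lborel \<partial>lborel)" (is "?L = ?R")
proof (cases "c = 0")
  case True
  with cs have s: "\<bar>s\<bar> = 1"
    by (simp add: abs_square_eq_1)
  have "(\<integral>\<^sup>+y. F (- s * y) v \<partial>lborel) = (\<integral>\<^sup>+y. F y v \<partial>lborel)" for v
    using s nn_integral_real_affine[of "\<lambda>u. F u v" "- s" 0] by auto
  then have "?L = (\<integral>\<^sup>+x. \<integral>\<^sup>+y. F y (s * x) \<partial>lborel \<partial>lborel)"
    by (simp add: True)
  also have "\<dots> = (\<integral>\<^sup>+x. \<integral>\<^sup>+y. F y x \<partial>lborel \<partial>lborel)"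
    using s nn_integral_real_affine[of "\<lambda>x. \<integral>\<^sup>+y. F y x \<partial>lborel" s 0] by auto
  also have "\<dots> = ?R"
    by (rule lborel_pair.Fubini') simp
  finally show ?thesis .
next
  case c: False
  \<comment> \<open>The second coordinate of the rotated point, written with the new first
    coordinate and the old \<open>y\<close>.\<close>
  have 1: "(s * (c * x - s * y) + y) / c = s * x + c * y" for x y
  proof -
    have "s * (c * x - s * y) + y = s * c * x + (1 - s\<^sup>2) * y"
      by (simp add: algebra_simps power2_eq_square)
    also have "1 - s\<^sup>2 = c\<^sup>2"
      using cs by simp
    finally show ?thesis
      using c by (simp add: field_simps power2_eq_square)
  qed
  \<comment> \<open>Both sides carry the factor \<open>\<bar>c\<bar>\<close>, which spares a
    division in \<open>ennreal\<close>; it is positive and finite, so it cancels at the end.\<close>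
  have "\<bar>c\<bar> * ?L = \<bar>c\<bar> * (\<integral>\<^sup>+y. \<integral>\<^sup>+x. F (c * x - s * y) (s * x + c * y) \<partial>lborel \<partial>lborel)"
    by (subst lborel_pair.Fubini') simp_all
  also have "\<dots> = (\<integral>\<^sup>+y. \<bar>c\<bar> * (\<integral>\<^sup>+x. F (c * x - s * y) (s * x + c * y) \<partial>lborel) \<partial>lborel)"
    by (simp add: nn_integral_cmult)
  also have "\<dots> = (\<integral>\<^sup>+y. \<integral>\<^sup>+x. F x ((s * x + y) / c) \<partial>lborel \<partial>lborel)"
  proof (rule nn_integral_cong)
    fix y
    show "\<bar>c\<bar> * (\<integral>\<^sup>+x. F (c * x - s * y) (s * x + c * y) \<partial>lborel)
      = (\<integral>\<^sup>+x. F x ((s * x + y) / c) \<partial>lborel)"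
      by (subst (2) nn_integral_real_affine[OF _ c, where t = "- s * y"]) (auto simp: 1)
  qed
  also have "\<dots> = (\<integral>\<^sup>+x. \<integral>\<^sup>+y. F x ((s * x + y) / c) \<partial>lborel \<partial>lborel)"
    by (subst lborel_pair.Fubini') simp_all
  also have "\<dots> = (\<integral>\<^sup>+x. \<bar>c\<bar> * (\<integral>\<^sup>+y. F x y \<partial>lborel) \<partial>lborel)"
  proof (rule nn_integral_cong)
    fix x
    have "(\<integral>\<^sup>+y. F x y \<partial>lborel)
      = \<bar>1 / c\<bar> * (\<integral>\<^sup>+y. F x (s * x / c + 1 / c * y) \<partial>lborel)"
      using c by (intro nn_integral_real_affine) auto
    then show "(\<integral>\<^sup>+y. F x ((s * x + y) / c) \<partial>lborel) = \<bar>c\<bar> * (\<integral>\<^sup>+y. F x y \<partial>lborel)"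
      using c by (simp add: add_divide_distrib mult.assoc[symmetric] ennreal_mult[symmetric])
  qed
  also have "\<dots> = \<bar>c\<bar> * ?R"
    by (simp add: nn_integral_cmult)
  finally show ?thesis
    using c by (simp add: ennreal_mult_cancel_left)
qed

text \<open>Variance one half: the law of the real or imaginary part of one entry of the
  noise.\<close>

definition real_gaussian :: "real measure" where
  "real_gaussian = density lborel (\<lambda>x. ennreal (normal_density 0 (sqrt (1/2)) x))"

lemma sets_real_gaussian [simp, measurable_cong]: "sets real_gaussian = sets borel"
  by (simp add: real_gaussian_def)

lemma prob_space_real_gaussian: "prob_space real_gaussian"
  unfolding real_gaussian_def by (rule prob_space_normal_density) simp

interpretation real_gaussian: prob_space real_gaussian
  by (rule prob_space_real_gaussian)

interpretation real_gaussian_pair: pair_sigma_finite real_gaussian real_gaussian ..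

lemma nn_integral_real_gaussian_pair:
  fixes F :: "real \<Rightarrow> real \<Rightarrow> ennreal"
  assumes [measurable]: "case_prod F \<in> borel_measurable (borel \<Otimes>\<^sub>M borel)"
  shows "(\<integral>\<^sup>+x. \<integral>\<^sup>+y. F x y \<partial>real_gaussian \<partial>real_gaussian)
    = (\<integral>\<^sup>+x. \<integral>\<^sup>+y. ennreal (exp (- (x\<^sup>2 + y\<^sup>2)) / pi) * F x y \<partial>lborel \<partial>lborel)"
proof -
  have eq: "exp (- x\<^sup>2 - y\<^sup>2) / pi
    = normal_density 0 (sqrt (1/2)) x * normal_density 0 (sqrt (1/2)) y" for x y
    by (simp add: normal_density_def exp_add[symmetric] algebra_simps)
  show ?thesis
    unfolding real_gaussian_def
    by (simp add: nn_integral_density eq ennreal_mult mult.assoc flip: nn_integral_cmult)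
qed

text \<open>A rotation preserves Lebesgue measure and also \<open>x\<^sup>2 + y\<^sup>2\<close>, on
  which alone the joint density depends.\<close>

lemma nn_integral_real_gaussian_rotate:
  fixes F :: "real \<Rightarrow> real \<Rightarrow> ennreal"
  assumes [measurable]: "case_prod F \<in> borel_measurable (borel \<Otimes>\<^sub>M borel)"
    and cs: "c\<^sup>2 + s\<^sup>2 = 1"
  shows "(\<integral>\<^sup>+x. \<integral>\<^sup>+y. F (c * x - s * y) (s * x + c * y) \<partial>real_gaussian \<partial>real_gaussian)
    = (\<integral>\<^sup>+x. \<integral>\<^sup>+y. F x y \<partial>real_gaussian \<partial>real_gaussian)"
proof -
  have "x\<^sup>2 + y\<^sup>2 = (c * x - s * y)\<^sup>2 + (s * x + c * y)\<^sup>2" for x y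
  proof -
    have "(c * x - s * y)\<^sup>2 + (s * x + c * y)\<^sup>2 = (c\<^sup>2 + s\<^sup>2) * (x\<^sup>2 + y\<^sup>2)"
      by (simp add: algebra_simps power2_eq_square)
    with cs show ?thesis
      by simp
  qed
  then show ?thesis
    using nn_integral_lborel_rotate[of "\<lambda>x y. ennreal (exp (- (x\<^sup>2 + y\<^sup>2)) / pi) * F x y", OF _ cs]
    by (simp add: nn_integral_real_gaussian_pair)
qed

text \<open>Rotate the plane so that the direction \<open>(a, b)\<close> becomes the first axis: the
  linear form is then a multiple of one coordinate, and the other coordinate integrates to
  one.\<close>

lemma nn_integral_real_gaussian_sum:
  fixes f :: "real \<Rightarrow> ennreal"
  assumes [measurable]: "f \<in> borel_measurable borel"
  shows "(\<integral>\<^sup>+x. \<integral>\<^sup>+y. f (a * x + b * y) \<partial>real_gaussian \<partial>real_gaussian)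
    = (\<integral>\<^sup>+x. f (sqrt (a\<^sup>2 + b\<^sup>2) * x) \<partial>real_gaussian)"
proof (cases "a\<^sup>2 + b\<^sup>2 = 0")
  case True
  then show ?thesis
    by (simp add: sum_power2_eq_zero_iff real_gaussian.emeasure_space_1)
next
  case False
  let ?r = "sqrt (a\<^sup>2 + b\<^sup>2)"
  have r: "?r \<noteq> 0"
    using False by simp
  \<comment> \<open>Cosine and sine of that rotation. The first rotated coordinate is
    \<open>c * x - s * y\<close>, hence the minus sign at \<open>b\<close>.\<close>
  have "(a / ?r)\<^sup>2 + (- b / ?r)\<^sup>2 = 1"
    using False by (simp add: power_divide add_divide_distrib[symmetric])
  moreover have "?r * (a / ?r * x - - b / ?r * y) = a * x + b * y" for x y
    using r by (simp add: field_simps del: real_sqrt_eq_0_iff)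
  ultimately show ?thesis
    using nn_integral_real_gaussian_rotate[of "\<lambda>x y. f (?r * x)" "a / ?r" "- b / ?r"]
    by (simp add: real_gaussian.emeasure_space_1 del: minus_divide_left)
qed

interpretation real_gaussian_prod: product_sigma_finite "\<lambda>_. real_gaussian" ..

text \<open>Circular symmetry: multiplication by \<open>k\<close> is a scaling by its modulus and a
  rotation by its phase, and the rotation preserves the Gaussian law.\<close>

lemma nn_integral_real_gaussian_scale:
  fixes F :: "complex \<Rightarrow> ennreal"
  assumes [measurable]: "F \<in> borel_measurable borel"
  shows "(\<integral>\<^sup>+x. \<integral>\<^sup>+y. F (z + k * Complex x y) \<partial>real_gaussian \<partial>real_gaussian)
    = (\<integral>\<^sup>+x. \<integral>\<^sup>+y. F (z + cmod k *\<^sub>R Complex x y) \<partial>real_gaussian \<partial>real_gaussian)"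
proof -
  \<comment> \<open>At \<open>k = 0\<close> the value \<open>sgn k\<close> is 0 and not a phase; any
    unit serves there.\<close>
  define e where "e = (if k = 0 then 1 else sgn k)"
  have k: "k = cmod k *\<^sub>R e"
    by (simp add: e_def sgn_div_norm)
  have "cmod e = 1"
    by (simp add: e_def norm_sgn)
  then have "(Re e)\<^sup>2 + (Im e)\<^sup>2 = 1"
    by (simp add: cmod_power2[symmetric])
  from nn_integral_real_gaussian_rotate
      [of "\<lambda>x y. F (z + cmod k *\<^sub>R Complex x y)", OF _ this]
  have "(\<integral>\<^sup>+x. \<integral>\<^sup>+y. F (z + cmod k *\<^sub>R Complex x y) \<partial>real_gaussian \<partial>real_gaussian)
    = (\<integral>\<^sup>+x. \<integral>\<^sup>+y. F (z + cmod k *\<^sub>R Complex (Re e * x - Im e * y) (Im e * x + Re e * y))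
        \<partial>real_gaussian \<partial>real_gaussian)"
    by (simp add: Complex_eq)
  moreover have "cmod k *\<^sub>R Complex (Re e * x - Im e * y) (Im e * x + Re e * y) = k * Complex x y"
    for x y
    by (subst (2) k) (simp add: complex_eq_iff algebra_simps)
  ultimately show ?thesis
    by simp
qed

text \<open>Once circular symmetry has removed the phase of \<open>k\<close>, the real and the
  imaginary parts are separate sums of two independent real Gaussians, and in each the scales add in
  quadrature.\<close>

lemma nn_integral_real_gaussian_complex_sum:
  fixes F :: "complex \<Rightarrow> ennreal"
  assumes [measurable]: "F \<in> borel_measurable borel"
  shows "(\<integral>\<^sup>+x. \<integral>\<^sup>+y. \<integral>\<^sup>+x'. \<integral>\<^sup>+y'. F (z + k * Complex x y + r *\<^sub>R Complex x' y')
      \<partial>real_gaussian \<partial>real_gaussian \<partial>real_gaussian \<partial>real_gaussian)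
    = (\<integral>\<^sup>+x. \<integral>\<^sup>+y. F (z + sqrt ((cmod k)\<^sup>2 + r\<^sup>2) *\<^sub>R Complex x y) \<partial>real_gaussian \<partial>real_gaussian)"
proof -
  let ?\<rho> = "sqrt ((cmod k)\<^sup>2 + r\<^sup>2)"
  \<comment> \<open>\<open>G\<close> averages over the second Gaussian, so that the phase can be
    removed from the first one alone.\<close>
  define G where "G w = (\<integral>\<^sup>+x'. \<integral>\<^sup>+y'. F (w + r *\<^sub>R Complex x' y') \<partial>real_gaussian \<partial>real_gaussian)" for w
  have [measurable]: "G \<in> borel_measurable borel"
    unfolding G_def Complex_eq by measurable
  define H where "H a b = F (z + Complex a b)" for a b
  have [measurable]: "case_prod H \<in> borel_measurable (borel \<Otimes>\<^sub>M borel)"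
    unfolding H_def Complex_eq by measurable
  have sum_eq: "z + cmod k *\<^sub>R Complex x y + r *\<^sub>R Complex x' y'
    = z + Complex (cmod k * x + r * x') (cmod k * y + r * y')" for x y x' y'
    by (simp add: complex_eq_iff)
  have "(\<integral>\<^sup>+x. \<integral>\<^sup>+y. G (z + k * Complex x y) \<partial>real_gaussian \<partial>real_gaussian)
     = (\<integral>\<^sup>+x. \<integral>\<^sup>+y. G (z + cmod k *\<^sub>R Complex x y) \<partial>real_gaussian \<partial>real_gaussian)"
    by (rule nn_integral_real_gaussian_scale) simp
  also have "\<dots> = (\<integral>\<^sup>+x. \<integral>\<^sup>+y. \<integral>\<^sup>+x'. \<integral>\<^sup>+y'. H (cmod k * x + r * x') (cmod k * y + r * y')
      \<partial>real_gaussian \<partial>real_gaussian \<partial>real_gaussian \<partial>real_gaussian)"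
    unfolding G_def H_def by (simp only: sum_eq)
  \<comment> \<open>Exchanging the two middle integrals brings the imaginary parts together
    innermost. They are merged first, the real parts afterwards.\<close>
  also have "\<dots> = (\<integral>\<^sup>+x. \<integral>\<^sup>+x'. \<integral>\<^sup>+y. \<integral>\<^sup>+y'. H (cmod k * x + r * x') (cmod k * y + r * y')
      \<partial>real_gaussian \<partial>real_gaussian \<partial>real_gaussian \<partial>real_gaussian)"
    by (intro nn_integral_cong real_gaussian_pair.Fubini'[symmetric]) simp
  also have "\<dots> = (\<integral>\<^sup>+x. \<integral>\<^sup>+x'. \<integral>\<^sup>+y. H (cmod k * x + r * x') (?\<rho> * y)
      \<partial>real_gaussian \<partial>real_gaussian \<partial>real_gaussian)"
    by (intro nn_integral_cong nn_integral_real_gaussian_sum) simp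
  also have "\<dots> = (\<integral>\<^sup>+x. \<integral>\<^sup>+y. H (?\<rho> * x) (?\<rho> * y) \<partial>real_gaussian \<partial>real_gaussian)"
    by (rule nn_integral_real_gaussian_sum
        [of "\<lambda>a. \<integral>\<^sup>+y. H a (?\<rho> * y) \<partial>real_gaussian"]) measurable
  finally show ?thesis
    by (simp add: G_def H_def complex_scaleR)
qed

section \<open>The law of the matched filter output\<close>

text \<open>The squared norm is the sum of the squared real coordinates, so the density factors over
  the basis and the coordinates are independent. Comparing both measures on boxes is enough.\<close>

lemma distr_complex_gaussian_Basis:
  "distr complex_gaussian (\<Pi>\<^sub>M b\<in>(Basis :: (complex ^ 'n) set). borel) (\<lambda>w. \<lambda>b\<in>Basis. w \<bullet> b)
    = (\<Pi>\<^sub>M b\<in>Basis. real_gaussian)"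
proof (rule real_gaussian_prod.PiM_eqI)
  let ?f = "\<lambda>x. normal_density 0 (sqrt (1/2)) x"
  show "finite (Basis :: (complex ^ 'n) set)"
    by simp
  show "sets (distr complex_gaussian (\<Pi>\<^sub>M b\<in>(Basis :: (complex ^ 'n) set). borel)
      (\<lambda>w. \<lambda>b\<in>Basis. w \<bullet> b)) = sets (\<Pi>\<^sub>M b\<in>Basis. real_gaussian)"
    by (simp cong: sets_PiM_cong)
  fix A :: "complex ^ 'n \<Rightarrow> real set"
  assume "\<And>b. b \<in> Basis \<Longrightarrow> A b \<in> sets real_gaussian"
  then have A[measurable]: "\<And>b. b \<in> Basis \<Longrightarrow> A b \<in> sets borel"
    by simp
  have dens: "exp (- (norm w)\<^sup>2) / pi ^ CARD('n) = (\<Prod>b\<in>Basis. ?f (w \<bullet> b))"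
    for w :: "complex ^ 'n"
  proof -
    have f: "?f x = exp (- x\<^sup>2) / sqrt pi" for x
      by (simp add: normal_density_def)
    have "(\<Prod>b\<in>(Basis :: (complex ^ 'n) set). ?f (w \<bullet> b))
        = exp (\<Sum>b\<in>Basis. - (w \<bullet> b)\<^sup>2) / sqrt pi ^ DIM(complex ^ 'n)"
      by (simp only: f prod_dividef prod_constant exp_sum[OF finite_Basis])
    also have "(\<Sum>b\<in>Basis. - (w \<bullet> b)\<^sup>2) = - (norm w)\<^sup>2"
      unfolding sum_negf power2_norm_eq_inner euclidean_inner[of w w] by (simp add: power2_eq_square)
    also have "sqrt pi ^ DIM(complex ^ 'n) = pi ^ CARD('n)"
      by (simp add: power_mult mult.commute[of _ 2])
    finally show ?thesis ..
  qed
  have [measurable]: "(\<lambda>w. \<lambda>b\<in>Basis. w \<bullet> b)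
      \<in> measurable complex_gaussian (\<Pi>\<^sub>M b\<in>(Basis :: (complex ^ 'n) set). borel)"
    unfolding complex_gaussian_def by (intro measurable_restrict) simp
  have [measurable]: "Pi\<^sub>E Basis A \<in> sets (\<Pi>\<^sub>M b\<in>(Basis :: (complex ^ 'n) set). borel)"
    using A by (intro sets_PiM_I_finite) auto
  have "emeasure (distr complex_gaussian (\<Pi>\<^sub>M b\<in>(Basis :: (complex ^ 'n) set). borel)
      (\<lambda>w. \<lambda>b\<in>Basis. w \<bullet> b)) (Pi\<^sub>E Basis A)
    = (\<integral>\<^sup>+w. indicator (Pi\<^sub>E Basis A) (\<lambda>b\<in>Basis. w \<bullet> b) \<partial>(complex_gaussian :: (complex ^ 'n) measure))"
    by (subst nn_integral_indicator[symmetric], simp, subst nn_integral_distr) simp_all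
  also have "\<dots> = (\<integral>\<^sup>+w. (\<Prod>b\<in>Basis. ennreal (?f (w \<bullet> b)) * indicator (A b) (w \<bullet> b))
      \<partial>(lborel :: (complex ^ 'n) measure))"
  proof -
    \<comment> \<open>The indicator of a box factors over the coordinates like the density, so the
      Lebesgue integral splits into one-dimensional ones.\<close>
    have ind: "indicator (Pi\<^sub>E Basis A) (\<lambda>b\<in>Basis. w \<bullet> b)
      = (\<Prod>b\<in>Basis. indicator (A b) (w \<bullet> b) :: ennreal)" for w
    proof (cases "\<forall>b\<in>Basis. w \<bullet> b \<in> A b")
      case True
      then show ?thesis
        by (simp add: PiE_def Pi_def)
    next
      case False
      then have "(\<Prod>b\<in>Basis. indicator (A b) (w \<bullet> b) :: ennreal) = 0"
        by (intro prod_zero) (auto simp: indicator_def)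
      with False show ?thesis
        by (auto simp: indicator_def)
    qed
    show ?thesis
      unfolding complex_gaussian_def ind
      by (subst nn_integral_density)
        (simp_all add: dens prod.distrib prod_ennreal normal_density_nonneg)
  qed
  also have "\<dots> = (\<Prod>b\<in>Basis. \<integral>\<^sup>+x. ennreal (?f x) * indicator (A b) x \<partial>lborel)"
    by (rule nn_integral_lborel_prod) simp_all
  also have "\<dots> = (\<Prod>b\<in>Basis. emeasure real_gaussian (A b))"
    unfolding real_gaussian_def by (intro prod.cong refl emeasure_density[symmetric]) simp_all
  finally show "emeasure (distr complex_gaussian (\<Pi>\<^sub>M b\<in>(Basis :: (complex ^ 'n) set). borel)
      (\<lambda>w. \<lambda>b\<in>Basis. w \<bullet> b)) (Pi\<^sub>E Basis A) = (\<Prod>b\<in>Basis. emeasure real_gaussian (A b))" .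
qed

definition matched_filter :: "complex ^ 'n \<Rightarrow> complex ^ 'n \<Rightarrow> complex" where
  "matched_filter h y = (\<Sum>i\<in>UNIV. cnj (h $ i) * y $ i)"

lemma linear_matched_filter: "linear (matched_filter h)"
  by (rule linearI) (simp_all add: matched_filter_def sum.distrib algebra_simps scaleR_right.sum)

lemma matched_filter_axis: "matched_filter h (axis i a) = cnj (h $ i) * a"
  by (simp add: matched_filter_def axis_def if_distrib cong: if_cong)

lemma borel_measurable_matched_filter [measurable]:
  "matched_filter h \<in> borel_measurable borel"
  by (intro borel_measurable_continuous_onI linear_continuous_on linear_linear[THEN iffD1])
     (simp add: linear_conv_bounded_linear[symmetric] linear_matched_filter)

text \<open>Splits off one real coordinate. The offset \<open>z\<close> collects the contributions
  already split off.\<close>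

lemma nn_integral_PiM_real_gaussian_insert:
  fixes F :: "complex \<Rightarrow> ennreal" and v :: "'b \<Rightarrow> complex"
  assumes [measurable]: "F \<in> borel_measurable borel" and I: "finite I" "a \<notin> I"
  shows "(\<integral>\<^sup>+f. F (z + (\<Sum>b\<in>insert a I. f b *\<^sub>R v b)) \<partial>(\<Pi>\<^sub>M b\<in>insert a I. real_gaussian))
    = (\<integral>\<^sup>+x. \<integral>\<^sup>+f. F (z + x *\<^sub>R v a + (\<Sum>b\<in>I. f b *\<^sub>R v b)) \<partial>(\<Pi>\<^sub>M b\<in>I. real_gaussian) \<partial>real_gaussian)"
proof -
  have "(\<Sum>b\<in>I. (f(a := x)) b *\<^sub>R v b) = (\<Sum>b\<in>I. f b *\<^sub>R v b)" for f x
    using I by (intro sum.cong) auto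
  then show ?thesis
    using I by (subst real_gaussian_prod.product_nn_integral_insert_rev) (auto simp: add.assoc)
qed

text \<open>For \<open>J = UNIV\<close> this is the real basis of the space. The grouping by complex
  entries lets an induction over \<open>J\<close> add one complex Gaussian at a time.\<close>

definition block_basis :: "'n set \<Rightarrow> (complex ^ 'n) set" where
  "block_basis J = (\<Union>i\<in>J. {axis i 1, axis i \<i>})"

text \<open>Induction on \<open>J\<close>: the two real coordinates of a new entry form a complex
  Gaussian multiplied by \<open>cnj (h $ i)\<close>, which merges with the Gaussian of the remaining
  entries. The offset varies because the new contribution moves into it.\<close>

lemma nn_integral_PiM_block_basis:
  fixes F :: "complex \<Rightarrow> ennreal" and h :: "complex ^ 'n"
  assumes [measurable]: "F \<in> borel_measurable borel" and J: "finite J"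
  shows "(\<integral>\<^sup>+f. F (z + (\<Sum>b\<in>block_basis J. f b *\<^sub>R matched_filter h b)) \<partial>(\<Pi>\<^sub>M b\<in>block_basis J. real_gaussian))
    = (\<integral>\<^sup>+x. \<integral>\<^sup>+y. F (z + sqrt (\<Sum>i\<in>J. (cmod (h $ i))\<^sup>2) *\<^sub>R Complex x y) \<partial>real_gaussian \<partial>real_gaussian)"
  using J
proof (induction J arbitrary: z)
  case empty
  then show ?case
    by (simp add: block_basis_def PiM_empty nn_integral_count_space_finite real_gaussian.emeasure_space_1)
next
  case (insert i J)
  let ?B = "block_basis J" and ?a = "axis i 1 :: complex ^ 'n" and ?b = "axis i \<i> :: complex ^ 'n"
  let ?r = "sqrt (\<Sum>i\<in>J. (cmod (h $ i))\<^sup>2)"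
  have B: "block_basis (insert i J) = insert ?a (insert ?b ?B)"
    by (auto simp: block_basis_def)
  have fin: "finite ?B"
    using insert.hyps by (simp add: block_basis_def)
  have ab: "?a \<noteq> ?b" "?a \<notin> insert ?b ?B" "?b \<notin> ?B"
    using insert.hyps by (auto simp: block_basis_def axis_eq_axis)
  have *: "z + x *\<^sub>R matched_filter h ?a + y *\<^sub>R matched_filter h ?b
    = z + cnj (h $ i) * Complex x y" for x y
    by (simp add: matched_filter_axis Complex_eq scaleR_conv_of_real algebra_simps)
  have "(\<integral>\<^sup>+f. F (z + (\<Sum>b\<in>block_basis (insert i J). f b *\<^sub>R matched_filter h b))
      \<partial>(\<Pi>\<^sub>M b\<in>block_basis (insert i J). real_gaussian))
    = (\<integral>\<^sup>+x. \<integral>\<^sup>+y. \<integral>\<^sup>+f. F ((z + cnj (h $ i) * Complex x y) + (\<Sum>b\<in>?B. f b *\<^sub>R matched_filter h b))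
      \<partial>(\<Pi>\<^sub>M b\<in>?B. real_gaussian) \<partial>real_gaussian \<partial>real_gaussian)"
    using fin ab by (simp add: B nn_integral_PiM_real_gaussian_insert * del: sum.insert)
  also have "\<dots> = (\<integral>\<^sup>+x. \<integral>\<^sup>+y. \<integral>\<^sup>+x'. \<integral>\<^sup>+y'. F (z + cnj (h $ i) * Complex x y + ?r *\<^sub>R Complex x' y')
      \<partial>real_gaussian \<partial>real_gaussian \<partial>real_gaussian \<partial>real_gaussian)"
    \<comment> \<open>The induction hypothesis is applied inside the integrals, with the
      contribution of entry \<open>i\<close> as part of the offset.\<close>
    by (simp only: insert.IH)
  also have "\<dots> = (\<integral>\<^sup>+x. \<integral>\<^sup>+y. F (z + sqrt ((cmod (cnj (h $ i)))\<^sup>2 + ?r\<^sup>2) *\<^sub>R Complex x y)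
      \<partial>real_gaussian \<partial>real_gaussian)"
    by (rule nn_integral_real_gaussian_complex_sum) simp
  finally show ?case
    using insert.hyps by (simp add: sum_nonneg)
qed

lemma nn_integral_matched_filter:
  fixes F :: "complex \<Rightarrow> ennreal" and h :: "complex ^ 'n"
  assumes [measurable]: "F \<in> borel_measurable borel"
  shows "(\<integral>\<^sup>+w. F (matched_filter h w) \<partial>complex_gaussian)
    = (\<integral>\<^sup>+x. \<integral>\<^sup>+y. F (norm h *\<^sub>R Complex x y) \<partial>real_gaussian \<partial>real_gaussian)"
proof -
  have B: "block_basis UNIV = (Basis :: (complex ^ 'n) set)"
    by (auto simp: block_basis_def Basis_vec_def Basis_complex_def)
  \<comment> \<open>The leading 0 is the offset with which the induction result is used.\<close>
  have expand: "matched_filter h w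
      = 0 + (\<Sum>b\<in>Basis. (\<lambda>b\<in>Basis. w \<bullet> b) b *\<^sub>R matched_filter h b)" for w
    by (subst (1) euclidean_representation[of w, symmetric])
       (simp add: linear_sum[OF linear_matched_filter] linear_cmul[OF linear_matched_filter])
  have [measurable]: "(\<lambda>w. \<lambda>b\<in>Basis. w \<bullet> b)
      \<in> measurable complex_gaussian (\<Pi>\<^sub>M b\<in>(Basis :: (complex ^ 'n) set). borel)"
    unfolding complex_gaussian_def by (intro measurable_restrict) simp
  have "(\<integral>\<^sup>+w. F (matched_filter h w) \<partial>complex_gaussian)
    = (\<integral>\<^sup>+f. F (0 + (\<Sum>b\<in>Basis. f b *\<^sub>R matched_filter h b))
        \<partial>distr complex_gaussian (\<Pi>\<^sub>M b\<in>(Basis :: (complex ^ 'n) set). borel) (\<lambda>w. \<lambda>b\<in>Basis. w \<bullet> b))"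
    by (subst expand, subst nn_integral_distr) measurable
  also have "\<dots> = (\<integral>\<^sup>+x. \<integral>\<^sup>+y. F (0 + sqrt (\<Sum>i\<in>UNIV. (cmod (h $ i))\<^sup>2) *\<^sub>R Complex x y)
      \<partial>real_gaussian \<partial>real_gaussian)"
    unfolding distr_complex_gaussian_Basis unfolding B[symmetric]
    by (rule nn_integral_PiM_block_basis) simp_all
  finally show ?thesis
    by (simp add: norm_vec_def L2_set_def)
qed

text \<open>The integrals computed above involve the gain vector only through its norm. The two
  vectors may have different dimensions, so here the number of antennas drops out.\<close>

lemma distr_matched_filter_cong:
  fixes h :: "complex ^ 'b" and g :: "complex ^ 'e"
  assumes "norm h = norm g"
  shows "distr complex_gaussian borel (matched_filter h)
    = distr complex_gaussian borel (matched_filter g)"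
proof (rule measure_eqI)
  fix A :: "complex set"
  assume "A \<in> sets (distr complex_gaussian borel (matched_filter h))"
  then have [measurable]: "A \<in> sets borel"
    by simp
  have meas: "matched_filter k \<in> borel_measurable complex_gaussian" for k :: "complex ^ 'n"
    by (simp add: complex_gaussian_def)
  have "emeasure (distr complex_gaussian borel (matched_filter k)) A
    = (\<integral>\<^sup>+x. \<integral>\<^sup>+y. indicator A (norm k *\<^sub>R Complex x y) \<partial>real_gaussian \<partial>real_gaussian)"
    for k :: "complex ^ 'n"
    using meas[of k]
    by (subst nn_integral_indicator[symmetric], simp, subst nn_integral_distr)
       (simp_all add: nn_integral_matched_filter)
  from this[of h] this[of g] assms
  show "emeasure (distr complex_gaussian borel (matched_filter h)) A
    = emeasure (distr complex_gaussian borel (matched_filter g)) A"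
    by simp
qed simp

section \<open>Densities relative to the noise law\<close>

lemma sets_complex_gaussian [simp, measurable_cong]: "sets complex_gaussian = sets borel"
  by (simp add: complex_gaussian_def)

lemma space_complex_gaussian [simp]: "space complex_gaussian = UNIV"
  by (simp add: complex_gaussian_def)

lemma borel_measurable_vec_scale [measurable (raw)]:
  fixes f :: "'a \<Rightarrow> complex"
  assumes "f \<in> borel_measurable M"
  shows "(\<lambda>x. f x *s (h :: complex ^ 'n)) \<in> borel_measurable M"
proof -
  have "linear (\<lambda>x. x *s h)"
    by (rule linearI) (simp_all add: vec_eq_iff algebra_simps)
  then have "(\<lambda>x. x *s h) \<in> borel_measurable borel"
    by (intro borel_measurable_continuous_onI linear_continuous_on linear_conv_bounded_linear[THEN iffD1])
  with assms show ?thesis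
    by (rule measurable_compose)
qed

text \<open>The density of a translated Gaussian relative to the centred one, as in the
  Cameron-Martin formula. With the noise law as reference, rather than Lebesgue measure, the law of
  the filter output becomes applicable.\<close>

lemma nn_integral_complex_gaussian_shift:
  fixes F :: "complex ^ 'n \<Rightarrow> ennreal"
  assumes [measurable]: "F \<in> borel_measurable borel"
  shows "(\<integral>\<^sup>+w. F (v + w) \<partial>complex_gaussian)
    = (\<integral>\<^sup>+y. F y * ennreal (exp ((norm y)\<^sup>2 - (norm (y - v))\<^sup>2)) \<partial>complex_gaussian)"
proof -
  let ?g = "\<lambda>w :: complex ^ 'n. ennreal (exp (- (norm w)\<^sup>2) / pi ^ CARD('n))"
  have g: "?g y * ennreal (exp ((norm y)\<^sup>2 - (norm (y - v))\<^sup>2)) = ?g (y - v)" for y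
    by (simp add: ennreal_mult[symmetric] exp_add[symmetric])
  have "(\<integral>\<^sup>+w. F (v + w) \<partial>complex_gaussian) = (\<integral>\<^sup>+w. ?g ((v + w) - v) * F (v + w) \<partial>lborel)"
    unfolding complex_gaussian_def by (subst nn_integral_density) simp_all
  also have "\<dots> = (\<integral>\<^sup>+y. ?g (y - v) * F y \<partial>distr lborel borel ((+) v))"
    by (subst nn_integral_distr) simp_all
  also have "\<dots> = (\<integral>\<^sup>+y. ?g (y - v) * F y \<partial>lborel)"
    by (simp add: lborel_distr_plus)
  also have "\<dots> = (\<integral>\<^sup>+y. F y * ennreal (exp ((norm y)\<^sup>2 - (norm (y - v))\<^sup>2)) \<partial>complex_gaussian)"
    unfolding complex_gaussian_def
    by (subst nn_integral_density) (simp_all add: g[symmetric] mult.assoc mult.commute[of "F _"])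
  finally show ?thesis .
qed

text \<open>Expanding the square entry by entry shows that \<open>y\<close> enters the exponent only
  through the filter output: the matched filter is a sufficient statistic.\<close>

lemma norm_diff_scale_matched_filter:
  fixes h y :: "complex ^ 'n"
  shows "(norm y)\<^sup>2 - (norm (y - x *s h))\<^sup>2
    = 2 * (x \<bullet> matched_filter h y) - (norm h)\<^sup>2 * (cmod x)\<^sup>2"
proof -
  have norm2: "(norm z)\<^sup>2 = (\<Sum>i\<in>UNIV. (cmod (z $ i))\<^sup>2)" for z :: "complex ^ 'n"
    by (simp add: norm_vec_def L2_set_def sum_nonneg)
  have "(cmod a)\<^sup>2 - (cmod (a - x * b))\<^sup>2 = 2 * (x \<bullet> (cnj b * a)) - (cmod b)\<^sup>2 * (cmod x)\<^sup>2" for a b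
    unfolding cmod_power2 inner_complex_def by (simp add: power2_eq_square algebra_simps)
  then show ?thesis
    by (simp add: norm2 matched_filter_def inner_sum_right sum_distrib_left sum_distrib_right
      sum_subtractf[symmetric])
qed

text \<open>With \<open>s\<close> the squared gain norm and \<open>t\<close> the filter output, this
  is the density of the channel output given the message, relative to the noise law. The dimension
  of the output does not occur in it.\<close>

definition likelihood :: "('u \<Rightarrow> complex measure) \<Rightarrow> real \<Rightarrow> 'u \<Rightarrow> complex \<Rightarrow> ennreal" where
  "likelihood c s u t = (\<integral>\<^sup>+x. ennreal (exp (2 * (x \<bullet> t) - s * (cmod x)\<^sup>2)) \<partial>c u)"

section \<open>The joint law of message and output\<close>

text \<open>One precoder with one message law; the two input distributions are two instances with
  the same \<open>c\<close>.\<close>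

locale precoded_source =
  fixes U :: "'u measure" and c :: "'u \<Rightarrow> complex measure" and pu :: "'u measure"
  assumes c: "c \<in> measurable U (prob_algebra borel)"
    and pu: "pu \<in> space (prob_algebra U)"
begin

lemma sets_pu [simp, measurable_cong]: "sets pu = sets U"
  using pu by (simp add: space_prob_algebra)

lemma space_pu [simp]: "space pu = space U"
  by (rule sets_eq_imp_space_eq) simp

sublocale pu: prob_space pu
  using pu by (simp add: space_prob_algebra)

lemma emeasure_pu_space [simp]: "emeasure pu (space U) = 1"
  using pu.emeasure_space_1 by simp

lemma sets_c [simp]: "u \<in> space U \<Longrightarrow> sets (c u) = sets borel"
  using measurable_space[OF c] by (simp add: space_prob_algebra)

lemma prob_space_c: "u \<in> space U \<Longrightarrow> prob_space (c u)"
  using measurable_space[OF c] by (simp add: space_prob_algebra)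

lemma measurable_c [measurable]: "c \<in> measurable U (subprob_algebra borel)"
  using c by (rule measurable_prob_algebraD)

lemma sets_input_dist [simp, measurable_cong]: "sets (input_dist U pu c) = sets (U \<Otimes>\<^sub>M borel)"
  and prob_space_input_dist: "prob_space (input_dist U pu c)"
  using input_dist_in_prob_algebra[OF c pu] by (simp_all add: space_prob_algebra)

lemma nn_integral_input_dist:
  assumes [measurable]: "F \<in> borel_measurable (U \<Otimes>\<^sub>M borel)"
  shows "(\<integral>\<^sup>+z. F z \<partial>input_dist U pu c) = (\<integral>\<^sup>+u. \<integral>\<^sup>+x. F (u, x) \<partial>c u \<partial>pu)"
proof -
  have "(\<lambda>u. c u \<bind> (\<lambda>x. return (U \<Otimes>\<^sub>M borel) (u, x))) \<in> measurable pu (subprob_algebra (U \<Otimes>\<^sub>M borel))"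
    by measurable
  then have "(\<integral>\<^sup>+z. F z \<partial>input_dist U pu c)
    = (\<integral>\<^sup>+u. \<integral>\<^sup>+z. F z \<partial>(c u \<bind> (\<lambda>x. return (U \<Otimes>\<^sub>M borel) (u, x))) \<partial>pu)"
    unfolding input_dist_def by (intro nn_integral_bind[where B = "U \<Otimes>\<^sub>M borel"]) simp_all
  also have "\<dots> = (\<integral>\<^sup>+u. \<integral>\<^sup>+x. F (u, x) \<partial>c u \<partial>pu)"
  proof (rule nn_integral_cong)
    fix u
    assume "u \<in> space pu"
    then have u [simp]: "u \<in> space U"
      by simp
    have [measurable_cong]: "sets (c u) = sets borel"
      by simp
    have "(\<integral>\<^sup>+z. F z \<partial>(c u \<bind> (\<lambda>x. return (U \<Otimes>\<^sub>M borel) (u, x))))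
      = (\<integral>\<^sup>+x. \<integral>\<^sup>+z. F z \<partial>return (U \<Otimes>\<^sub>M borel) (u, x) \<partial>c u)"
      by (intro nn_integral_bind[where B = "U \<Otimes>\<^sub>M borel"]) measurable
    also have "\<dots> = (\<integral>\<^sup>+x. F (u, x) \<partial>c u)"
      by (intro nn_integral_cong nn_integral_return) (simp_all add: space_pair_measure)
    finally show "(\<integral>\<^sup>+z. F z \<partial>(c u \<bind> (\<lambda>x. return (U \<Otimes>\<^sub>M borel) (u, x)))) = (\<integral>\<^sup>+x. F (u, x) \<partial>c u)" .
  qed
  finally show ?thesis .
qed

lemma borel_measurable_likelihood [measurable]:
  "case_prod (likelihood c s) \<in> borel_measurable (U \<Otimes>\<^sub>M borel)"
proof -
  have "(\<lambda>z. integral\<^sup>N (c (fst z)) (\<lambda>x. ennreal (exp (2 * (x \<bullet> snd z) - s * (cmod x)\<^sup>2))))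
      \<in> borel_measurable (U \<Otimes>\<^sub>M borel)"
    by (rule nn_integral_measurable_subprob_algebra2[where N = borel]) simp_all
  then show ?thesis
    by (simp add: likelihood_def case_prod_beta')
qed

lemma likelihood_pos:
  assumes u: "u \<in> space U"
  shows "likelihood c s u t > 0"
proof -
  interpret cu: prob_space "c u"
    using u by (rule prob_space_c)
  have "(\<lambda>x. ennreal (exp (2 * (x \<bullet> t) - s * (cmod x)\<^sup>2))) \<in> borel_measurable (c u)"
    by (subst measurable_cong_sets[OF sets_c[OF u] refl]) measurable
  then have "likelihood c s u t \<noteq> 0"
    unfolding likelihood_def by (subst nn_integral_0_iff_AE) (simp_all add: cu.AE_False)
  then show ?thesis
    by (simp add: zero_less_iff_neq_zero)
qed

text \<open>At a filter output the exponent is a difference of squared norms whose first term is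
  \<open>(norm y)\<^sup>2\<close>. The bound gives finiteness, so that passing to real densities
  loses nothing.\<close>

lemma likelihood_matched_filter_le:
  assumes u: "u \<in> space U"
  shows "likelihood c ((norm h)\<^sup>2) u (matched_filter h y) \<le> ennreal (exp ((norm y)\<^sup>2))"
proof -
  interpret cu: prob_space "c u"
    using u by (rule prob_space_c)
  have "likelihood c ((norm h)\<^sup>2) u (matched_filter h y) \<le> (\<integral>\<^sup>+x. ennreal (exp ((norm y)\<^sup>2)) \<partial>c u)"
    unfolding likelihood_def norm_diff_scale_matched_filter[symmetric]
    by (intro nn_integral_mono ennreal_leI) simp
  then show ?thesis
    by (simp add: cu.emeasure_space_1)
qed

text \<open>The density of the channel output with the message averaged out, in the same
  parametrisation as \<open>likelihood\<close>.\<close>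

definition output_likelihood :: "real \<Rightarrow> complex \<Rightarrow> ennreal" where
  "output_likelihood s t = (\<integral>\<^sup>+u. likelihood c s u t \<partial>pu)"

lemma borel_measurable_output_likelihood [measurable]:
  "output_likelihood s \<in> borel_measurable borel"
  unfolding output_likelihood_def by measurable

lemma output_likelihood_pos: "output_likelihood s t > 0"
proof -
  have "output_likelihood s t \<noteq> 0"
    unfolding output_likelihood_def
  proof (subst nn_integral_0_iff_AE)
    show "\<not> (AE u in pu. likelihood c s u t = 0)"
    proof
      assume "AE u in pu. likelihood c s u t = 0"
      then have "AE u in pu. False"
        by (rule AE_mp) (use likelihood_pos in \<open>auto intro!: AE_I2 simp: less_le\<close>)
      then show False
        by simp
    qed
  qed measurable
  then show ?thesis
    by (simp add: zero_less_iff_neq_zero)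
qed

lemma output_likelihood_matched_filter_le:
  "output_likelihood ((norm h)\<^sup>2) (matched_filter h y) \<le> ennreal (exp ((norm y)\<^sup>2))"
proof -
  have "output_likelihood ((norm h)\<^sup>2) (matched_filter h y) \<le> (\<integral>\<^sup>+u. ennreal (exp ((norm y)\<^sup>2)) \<partial>pu)"
    unfolding output_likelihood_def by (intro nn_integral_mono likelihood_matched_filter_le) simp
  then show ?thesis
    by simp
qed

text \<open>For fixed \<open>u\<close> and \<open>x\<close>, the shift formula turns the signal
  \<open>x *s h\<close> into an exponential weight on the noise law; integrating this weight over
  \<open>x\<close> gives the likelihood. So the likelihood is the joint density of message and
  output.\<close>

lemma nn_integral_channel:
  fixes h :: "complex ^ 'n"
  assumes [measurable]: "F \<in> borel_measurable (U \<Otimes>\<^sub>M borel)"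
  shows "(\<integral>\<^sup>+((u, x), w). F (u, x *s h + w) \<partial>(input_dist U pu c \<Otimes>\<^sub>M complex_gaussian))
    = (\<integral>\<^sup>+(u, y). likelihood c ((norm h)\<^sup>2) u (matched_filter h y) * F (u, y) \<partial>(pu \<Otimes>\<^sub>M complex_gaussian))"
proof -
  interpret gauss: prob_space "complex_gaussian :: (complex ^ 'n) measure"
    by (rule prob_space_complex_gaussian)
  have [measurable]: "(\<lambda>((u, x), w). F (u, x *s h + w))
      \<in> borel_measurable (input_dist U pu c \<Otimes>\<^sub>M complex_gaussian)"
    by (simp add: case_prod_beta')
  have "(\<integral>\<^sup>+((u, x), w). F (u, x *s h + w) \<partial>(input_dist U pu c \<Otimes>\<^sub>M complex_gaussian))
    = (\<integral>\<^sup>+z. \<integral>\<^sup>+w. F (fst z, snd z *s h + w) \<partial>complex_gaussian \<partial>input_dist U pu c)"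
    by (subst gauss.nn_integral_fst[symmetric]) (simp_all add: case_prod_beta)
  also have "\<dots> = (\<integral>\<^sup>+u. \<integral>\<^sup>+x. \<integral>\<^sup>+w. F (u, x *s h + w) \<partial>complex_gaussian \<partial>c u \<partial>pu)"
    by (subst nn_integral_input_dist) simp_all
  also have "\<dots> = (\<integral>\<^sup>+u. \<integral>\<^sup>+y. likelihood c ((norm h)\<^sup>2) u (matched_filter h y) * F (u, y)
      \<partial>complex_gaussian \<partial>pu)"
  proof (rule nn_integral_cong)
    fix u
    assume "u \<in> space pu"
    then have u [simp]: "u \<in> space U"
      by simp
    have sets_cu [measurable_cong]: "sets (c u) = sets borel"
      by simp
    interpret cu: prob_space "c u"
      using u by (rule prob_space_c)
    interpret cg: pair_sigma_finite "c u" "complex_gaussian :: (complex ^ 'n) measure" ..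
    have "(\<integral>\<^sup>+x. \<integral>\<^sup>+w. F (u, x *s h + w) \<partial>complex_gaussian \<partial>c u)
      = (\<integral>\<^sup>+x. \<integral>\<^sup>+y. F (u, y) * ennreal (exp ((norm y)\<^sup>2 - (norm (y - x *s h))\<^sup>2)) \<partial>complex_gaussian \<partial>c u)"
      by (intro nn_integral_cong nn_integral_complex_gaussian_shift[of "\<lambda>y. F (u, y)"]) simp
    also have "\<dots> = (\<integral>\<^sup>+y. \<integral>\<^sup>+x. F (u, y) * ennreal (exp ((norm y)\<^sup>2 - (norm (y - x *s h))\<^sup>2)) \<partial>c u \<partial>complex_gaussian)"
      by (rule cg.Fubini'[symmetric]) simp
    also have "\<dots> = (\<integral>\<^sup>+y. likelihood c ((norm h)\<^sup>2) u (matched_filter h y) * F (u, y) \<partial>complex_gaussian)"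
      unfolding likelihood_def norm_diff_scale_matched_filter[symmetric]
      by (intro nn_integral_cong) (simp add: nn_integral_cmult mult.commute)
    finally show "(\<integral>\<^sup>+x. \<integral>\<^sup>+w. F (u, x *s h + w) \<partial>complex_gaussian \<partial>c u)
      = (\<integral>\<^sup>+y. likelihood c ((norm h)\<^sup>2) u (matched_filter h y) * F (u, y) \<partial>complex_gaussian)" .
  qed
  also have "\<dots> = (\<integral>\<^sup>+(u, y). likelihood c ((norm h)\<^sup>2) u (matched_filter h y) * F (u, y) \<partial>(pu \<Otimes>\<^sub>M complex_gaussian))"
    by (subst gauss.nn_integral_fst[symmetric]) (simp_all add: case_prod_beta)
  finally show ?thesis .
qed

section \<open>Mutual information as a function of the gain norm\<close>

text \<open>Mutual information is the divergence of the joint law from the product of its marginals.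
  Both have densities relative to \<open>pu\<close> times the noise law that see the output only
  through the matched filter, so the integral can be pushed forward along it.\<close>

lemma channel_mi_eq:
  fixes h :: "complex ^ 'n"
  shows "channel_mi U (input_dist U pu c) h
    = (\<integral>(u, t). enn2real (likelihood c ((norm h)\<^sup>2) u t)
        * log 2 (enn2real (likelihood c ((norm h)\<^sup>2) u t) / enn2real (output_likelihood ((norm h)\<^sup>2) t))
      \<partial>(pu \<Otimes>\<^sub>M distr complex_gaussian borel (matched_filter h)))"
proof -
  let ?d = "input_dist U pu c" and ?G = "complex_gaussian :: (complex ^ 'n) measure"
  let ?s = "(norm h)\<^sup>2"
  let ?M = "?d \<Otimes>\<^sub>M ?G"
  let ?X = "\<lambda>((u, x), w). u" and ?Y = "\<lambda>((u, x), w). x *s h + w"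
  let ?L = "\<lambda>z. likelihood c ?s (fst z) (matched_filter h (snd z))"
  let ?O = "\<lambda>y. output_likelihood ?s (matched_filter h y)"
  interpret gauss: prob_space ?G
    by (rule prob_space_complex_gaussian)
  interpret d: prob_space ?d
    by (rule prob_space_input_dist)
  interpret M: pair_prob_space ?d ?G ..
  interpret R: pair_prob_space pu ?G ..
  have [measurable]: "?X \<in> measurable ?M U" "?Y \<in> measurable ?M borel"
    by (simp_all add: case_prod_beta')
  have joint: "distr ?M (U \<Otimes>\<^sub>M borel) (\<lambda>z. (?X z, ?Y z)) = density (pu \<Otimes>\<^sub>M ?G) ?L" (is "?J = _")
  proof (rule measure_eqI)
    fix A
    assume "A \<in> sets ?J"
    then have [measurable]: "A \<in> sets (U \<Otimes>\<^sub>M borel)"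
      by simp
    have "emeasure ?J A = (\<integral>\<^sup>+z. indicator A z \<partial>?J)"
      by simp
    also have "\<dots> = (\<integral>\<^sup>+((u, x), w). indicator A (u, x *s h + w) \<partial>?M)"
      by (subst nn_integral_distr) (simp_all add: case_prod_beta')
    also have "\<dots> = emeasure (density (pu \<Otimes>\<^sub>M ?G) ?L) A"
      by (subst nn_integral_channel) (simp_all add: emeasure_density case_prod_beta')
    finally show "emeasure ?J A = emeasure (density (pu \<Otimes>\<^sub>M ?G) ?L) A" .
  qed (simp cong: sets_pair_measure_cong)
  have input_law: "distr ?M U ?X = pu"
  proof (rule measure_eqI)
    fix A
    assume "A \<in> sets (distr ?M U ?X)"
    then have [measurable]: "A \<in> sets U"
      by simp
    have "emeasure (distr ?M U ?X) A = (\<integral>\<^sup>+z. indicator A z \<partial>distr ?M U ?X)"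
      by simp
    also have "\<dots> = (\<integral>\<^sup>+z. indicator A (fst (fst z)) \<partial>?M)"
      by (subst nn_integral_distr) (simp_all add: case_prod_beta)
    also have "\<dots> = (\<integral>\<^sup>+z. indicator A (fst z) \<partial>?d)"
      by (subst gauss.nn_integral_fst[symmetric])
        (simp_all add: gauss.emeasure_space_1[simplified])
    also have "\<dots> = (\<integral>\<^sup>+u. indicator A u \<partial>pu)"
    proof (subst nn_integral_input_dist, simp, rule nn_integral_cong)
      fix u
      assume "u \<in> space pu"
      then show "(\<integral>\<^sup>+x. indicator A (fst (u, x)) \<partial>c u) = (indicator A u :: ennreal)"
        by (simp add: prob_space.emeasure_space_1[OF prob_space_c])
    qed
    also have "\<dots> = emeasure pu A"
      by simp
    finally show "emeasure (distr ?M U ?X) A = emeasure pu A" .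
  qed simp
  have output_law: "distr ?M borel ?Y = density ?G ?O"
  proof (rule measure_eqI)
    fix A
    assume "A \<in> sets (distr ?M borel ?Y)"
    then have [measurable]: "A \<in> sets borel"
      by simp
    have "emeasure (distr ?M borel ?Y) A = (\<integral>\<^sup>+z. indicator A z \<partial>distr ?M borel ?Y)"
      by simp
    \<comment> \<open>The output is written as a component of the pair, to fit the form of
      \<open>nn_integral_channel\<close>.\<close>
    also have "\<dots> = (\<integral>\<^sup>+((u, x), w). indicator A (snd (u, x *s h + w)) \<partial>?M)"
      by (subst nn_integral_distr) (simp_all add: case_prod_beta')
    also have "\<dots> = (\<integral>\<^sup>+z. ?L z * indicator A (snd z) \<partial>(pu \<Otimes>\<^sub>M ?G))"
      by (subst nn_integral_channel) (simp_all add: case_prod_beta')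
    also have "\<dots> = (\<integral>\<^sup>+y. ?O y * indicator A y \<partial>?G)"
      by (subst R.nn_integral_snd[symmetric])
        (simp_all add: output_likelihood_def nn_integral_multc)
    also have "\<dots> = emeasure (density ?G ?O) A"
      by (simp add: emeasure_density)
    finally show "emeasure (distr ?M borel ?Y) A = emeasure (density ?G ?O) A" .
  qed simp
  have O_real: "ennreal (enn2real (?O y)) = ?O y" for y
    using output_likelihood_matched_filter_le[of h y]
    by (intro ennreal_enn2real) (auto simp: less_top[symmetric] top_unique)
  have L_real: "ennreal (enn2real (?L (u, y))) = ?L (u, y)" if "u \<in> space U" for u y
    using likelihood_matched_filter_le[OF that, of h y]
    by (intro ennreal_enn2real) (auto simp: less_top[symmetric] top_unique)
  \<comment> \<open>A density of the product law that never vanishes makes the joint law absolutely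
    continuous with respect to it, as the divergence formula requires.\<close>
  have O_pos: "enn2real (?O y) \<noteq> 0" for y
    using O_real[of y] output_likelihood_pos[of ?s "matched_filter h y"] by force
  have prod: "pu \<Otimes>\<^sub>M density ?G ?O = density (pu \<Otimes>\<^sub>M ?G) (\<lambda>z. ennreal (enn2real (?O (snd z))))"
  proof -
    \<comment> \<open>Supplies the sigma-finiteness that the product formula for densities asks
      for.\<close>
    interpret out: prob_space "density ?G ?O"
      unfolding output_law[symmetric] by (rule M.prob_space_distr) measurable
    have "pu \<Otimes>\<^sub>M density ?G ?O = density pu (\<lambda>_. 1) \<Otimes>\<^sub>M density ?G ?O"
      by (simp add: density_1)
    also have "\<dots> = density (pu \<Otimes>\<^sub>M ?G) (\<lambda>(u, y). 1 * ?O y)"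
      by (rule pair_measure_density)
        (simp_all add: gauss.sigma_finite_measure_axioms out.sigma_finite_measure_axioms)
    finally show ?thesis
      by (simp add: O_real case_prod_beta')
  qed
  have dens_L: "density (pu \<Otimes>\<^sub>M ?G) ?L = density (pu \<Otimes>\<^sub>M ?G) (\<lambda>z. ennreal (enn2real (?L z)))"
    by (rule density_cong) (auto simp: L_real[simplified] space_pair_measure intro!: AE_I2)
  have "channel_mi U ?d h = KL_divergence 2 (density (pu \<Otimes>\<^sub>M ?G) (\<lambda>z. ennreal (enn2real (?O (snd z)))))
      (density (pu \<Otimes>\<^sub>M ?G) (\<lambda>z. ennreal (enn2real (?L z))))"
    unfolding channel_mi_def M.mutual_information_def joint input_law output_law prod dens_L ..
  also have "\<dots> = (\<integral>z. enn2real (?L z) * log 2 (enn2real (?L z) / enn2real (?O (snd z))) \<partial>(pu \<Otimes>\<^sub>M ?G))"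
    by (rule R.KL_density_density) (simp_all add: O_pos)
  also have "\<dots> = (\<integral>(u, t). enn2real (likelihood c ?s u t)
        * log 2 (enn2real (likelihood c ?s u t) / enn2real (output_likelihood ?s t))
      \<partial>distr (pu \<Otimes>\<^sub>M ?G) (pu \<Otimes>\<^sub>M borel) (\<lambda>(u, y). (u, matched_filter h y)))"
    by (subst integral_distr) (simp_all add: case_prod_beta')
  also have "distr (pu \<Otimes>\<^sub>M ?G) (pu \<Otimes>\<^sub>M borel) (\<lambda>(u, y). (u, matched_filter h y))
    = distr pu pu (\<lambda>u. u) \<Otimes>\<^sub>M distr ?G borel (matched_filter h)"
    by (rule pair_measure_distr[symmetric])
      (simp_all add: prob_space_imp_sigma_finite gauss.prob_space_distr)
  finally show ?thesis
    by simp
qed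

text \<open>In \<open>channel_mi_eq\<close> the gain vector occurs only through its norm and through
  the law of its filter output, which the norm determines.\<close>

lemma channel_mi_norm_cong:
  fixes h :: "complex ^ 'b" and g :: "complex ^ 'e"
  assumes "norm h = norm g"
  shows "channel_mi U (input_dist U pu c) h = channel_mi U (input_dist U pu c) g"
  using distr_matched_filter_cong[OF assms] assms by (simp add: channel_mi_eq)

end

section \<open>Deterministic channels and the dichotomy\<close>

text \<open>The product of two point masses evaluates an integrand at one point. The positive and
  the negative part are finite there, so the expectation exists.\<close>

lemma ext_expectation_return_pair:
  fixes f :: "'a \<times> 'b \<Rightarrow> real"
  assumes [measurable]: "f \<in> borel_measurable (A \<Otimes>\<^sub>M B)" and "a \<in> space A" "b \<in> space B"
  shows "has_ext_expectation (return A a \<Otimes>\<^sub>M return B b) f"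
    and "ext_expectation (return A a \<Otimes>\<^sub>M return B b) f = ereal (f (a, b))"
proof -
  interpret B: prob_space "return B b"
    using assms by (intro prob_space_return)
  note sets_return [measurable_cong]
  have int: "(\<integral>\<^sup>+z. F z \<partial>(return A a \<Otimes>\<^sub>M return B b)) = F (a, b)"
    if [measurable]: "F \<in> borel_measurable (A \<Otimes>\<^sub>M B)" for F :: "'a \<times> 'b \<Rightarrow> ennreal"
    using assms by (subst B.nn_integral_fst[symmetric]) (simp_all add: nn_integral_return)
  show "has_ext_expectation (return A a \<Otimes>\<^sub>M return B b) f"
    by (simp add: has_ext_expectation_def int)
  show "ext_expectation (return A a \<Otimes>\<^sub>M return B b) f = ereal (f (a, b))"
    by (cases "f (a, b) \<ge> 0") (simp_all add: ext_expectation_def int ennreal_neg enn2ereal_ennreal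
      zero_ennreal.rep_eq)
qed

lemma norm_axis: "norm (axis i x) = norm (x :: 'a :: real_inner)"
  by (simp add: norm_eq_sqrt_inner inner_axis_axis)

theorem theorem6:
  fixes U :: "'u measure"
    and c :: "'u \<Rightarrow> complex measure"
    and pu qu :: "'u measure"
    and P_T :: real
  defines "p \<equiv> input_dist U pu c" and "q \<equiv> input_dist U qu c"
  assumes "P_T > 0"
    and "c \<in> measurable U (prob_algebra borel)"
    and "pu \<in> space (prob_algebra U)" and "qu \<in> space (prob_algebra U)"
    and "(\<integral>\<^sup>+(u, x). ennreal ((cmod x)\<^sup>2) \<partial>p) = ennreal P_T"
    and "(\<integral>\<^sup>+(u, x). ennreal ((cmod x)\<^sup>2) \<partial>q) = ennreal P_T"
  shows "\<not> ((\<forall>(ph :: (complex ^ 'b) measure) (pg :: (complex ^ 'e) measure).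
               ph \<in> space (prob_algebra borel) \<and> pg \<in> space (prob_algebra borel) \<and>
               ESR_defined U p ph pg \<and> ESR_defined U q ph pg \<longrightarrow>
               ESR U p ph pg = ESR U q ph pg)
           \<longleftrightarrow>
           (\<exists>(ph :: (complex ^ 'b) measure) (pg :: (complex ^ 'e) measure).
               ph \<in> space (prob_algebra borel) \<and> pg \<in> space (prob_algebra borel) \<and>
               ESR_defined U p ph pg \<and> ESR_defined U q ph pg \<and>
               ESR U p ph pg < ESR U q ph pg))"
    (is "\<not> (?equal \<longleftrightarrow> ?less)")
proof -
  interpret p: precoded_source U c pu
    using assms by unfold_locales
  interpret q: precoded_source U c qu
    using assms by unfold_locales
  have ?less if "\<not> ?equal"
  proof -
    from that obtain ph :: "(complex ^ 'b) measure" and pg :: "(complex ^ 'e) measure"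
      where ph: "ph \<in> space (prob_algebra borel)" and pg: "pg \<in> space (prob_algebra borel)"
        and def: "ESR_defined U p ph pg" "ESR_defined U q ph pg"
        and neq: "ESR U p ph pg \<noteq> ESR U q ph pg"
      by blast
    \<comment> \<open>Measurability of the secrecy rates does not depend on the channel statistics, so it can be read
      off the hypothesis that the two rates exist.\<close>
    let ?B = "(borel :: (complex ^ 'b) measure) \<Otimes>\<^sub>M (borel :: (complex ^ 'e) measure)"
    have "sets (ph \<Otimes>\<^sub>M pg) = sets ?B"
      using ph pg by (intro sets_pair_measure_cong) (simp_all add: space_prob_algebra)
    then have "measurable (ph \<Otimes>\<^sub>M pg) borel = measurable ?B (borel :: real measure)"
      by (rule measurable_cong_sets) simp
    with def have meas: "secrecy_rate U p \<in> borel_measurable ?B" "secrecy_rate U q \<in> borel_measurable ?B"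
      unfolding ESR_defined_def has_ext_expectation_def by blast+
    \<comment> \<open>Point masses as channel statistics turn a strict inequality at one pair of
      gain vectors into one between ergodic rates.\<close>
    have witness: ?less
      if "secrecy_rate U p (h, g) < secrecy_rate U q (h, g)" for h :: "complex ^ 'b" and g :: "complex ^ 'e"
    proof (intro exI conjI)
      show "return borel h \<in> space (prob_algebra borel)" "return borel g \<in> space (prob_algebra borel)"
        by (simp_all add: space_prob_algebra prob_space_return)
      show "ESR_defined U p (return borel h) (return borel g)"
        "ESR_defined U q (return borel h) (return borel g)"
        using meas by (auto simp: ESR_defined_def intro!: ext_expectation_return_pair)
      show "ESR U p (return borel h) (return borel g) < ESR U q (return borel h) (return borel g)"
        using that meas by (simp add: ESR_def ext_expectation_return_pair)
    qed
    \<comment> \<open>The input distribution enters \<open>ESR\<close> only through this function,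
      so different rates force different functions.\<close>
    from neq have "(secrecy_rate U p :: (complex ^ 'b) \<times> (complex ^ 'e) \<Rightarrow> real) \<noteq> secrecy_rate U q"
      by (auto simp: ESR_def)
    then obtain h :: "complex ^ 'b" and g :: "complex ^ 'e"
      where hg: "secrecy_rate U p (h, g) \<noteq> secrecy_rate U q (h, g)"
      by (auto simp: fun_eq_iff)
    \<comment> \<open>The two spaces may differ in dimension, so the norms are exchanged rather than
      the vectors. The index \<open>undefined\<close> is an arbitrary one.\<close>
    let ?h = "axis undefined (complex_of_real (norm g)) :: complex ^ 'b"
    let ?g = "axis undefined (complex_of_real (norm h)) :: complex ^ 'e"
    have "norm ?h = norm g" "norm ?g = norm h"
      by (simp_all add: norm_axis)
    then have "channel_mi U d ?h = channel_mi U d g" "channel_mi U d ?g = channel_mi U d h"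
      if "d = p \<or> d = q" for d
      using that p.channel_mi_norm_cong q.channel_mi_norm_cong unfolding p_def q_def by blast+
    then have "secrecy_rate U d (?h, ?g) = - secrecy_rate U d (h, g)" if "d = p \<or> d = q" for d
      using that by (simp add: secrecy_rate_def)
    \<comment> \<open>If the inequality at \<open>(h, g)\<close> has the wrong direction, negating
      both sides makes it right at \<open>(?h, ?g)\<close>.\<close>
    with hg witness[of h g] witness[of ?h ?g] show ?less
      by force
  qed
  moreover have "\<not> ?less" if ?equal
    using that by (metis less_irrefl)
  ultimately show ?thesis
    by blast
qed

end
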